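(* Let $k\ge1$ be an integer, let $P_d,P_b,R_1,R_2>0$ and $S_1,\dots,S_{N_f}>0$, and let $E(\mathbf{b}|k)$ be the energy consumption function of $\mathbf{b}=(b_1,\dots,b_{N_f})\in[0,1]^{N_f}$ defined in the context. If $\frac{P_b}{R_2}>\frac{P_d}{R_1}$, then $E(\mathbf{b}|k)$ is a convex function of $\mathbf{b}$.
   Context: There are $k$ devices in a cluster and a library of $N_f$ files; file $i$ has size $S_i$ and is requested with Zipf probability $q_i=\frac{i^{-\beta}}{\sum_{l=1}^{N_f}l^{-\beta}}$, $\beta\ge 0$. Each device caches file $i$ with probability $b_i$. $P_d$ and $P_b$ are the device-to-device (D2D) and base-station transmission powers, and $R_1,R_2$ are the average D2D and base-station-to-device rates (they do not depend on $\mathbf{b}$). The energy consumption given $k$ devices is $$E(\mathbf{b}|k)=\sum_{j=1}^{k}\sum_{i=1}^{N_f}\Big[\mathbb{P}_{j,i}^d\,q_i\,P_d\,c_{d_i}+\mathbb{P}_{j,i}^b\,q_i\,P_b\,c_{b_i}\Big],$$ where $c_{d_i}=S_i/R_1$, $c_{b_i}=S_i/R_2$, $\mathbb{P}_{j,i}^b=(1-b_i)^k$ and $\mathbb{P}_{j,i}^d=(1-b_i)\big(1-(1-b_i)^{k-1}\big)$. *)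

theory Defs
  imports "HOL-Analysis.Analysis"
begin

text \<open>Files are numbered \<open>1, \<dots>, N\<close>; the caching vector is here a function of the file number.\<close>

definition zipf :: "real \<Rightarrow> nat \<Rightarrow> nat \<Rightarrow> real" where
  "zipf \<beta> N i = real i powr (- \<beta>) / (\<Sum>l=1..N. real l powr (- \<beta>))"

text \<open>
  The following two probabilities concern the request of one device for file \<open>i\<close> in a cluster
  of \<open>k\<close> devices. All devices cache file \<open>i\<close> with the same probability \<open>b i\<close>, so neither
  depends on which device makes the request.
  The file comes from the base station if none of the \<open>k\<close> devices caches it, and over a
  device-to-device link if the requesting device does not cache it but one of the others does.
\<close>

definition bs_prob :: "nat \<Rightarrow> (nat \<Rightarrow> real) \<Rightarrow> nat \<Rightarrow> real" where
  "bs_prob k b i = (1 - b i) ^ k"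

definition d2d_prob :: "nat \<Rightarrow> (nat \<Rightarrow> real) \<Rightarrow> nat \<Rightarrow> real" where
  "d2d_prob k b i = (1 - b i) * (1 - (1 - b i) ^ (k - 1))"

definition energy ::
  "real \<Rightarrow> nat \<Rightarrow> (nat \<Rightarrow> real) \<Rightarrow> real \<Rightarrow> real \<Rightarrow> real \<Rightarrow> real \<Rightarrow> nat \<Rightarrow> (nat \<Rightarrow> real) \<Rightarrow> real" where
  "energy \<beta> N S Pd Pb R1 R2 k b =
     (\<Sum>j=1..k. \<Sum>i=1..N.
        d2d_prob k b i * zipf \<beta> N i * Pd * (S i / R1) +
        bs_prob k b i * zipf \<beta> N i * Pb * (S i / R2))"

end

theory Submission
  imports Defs
begin

text \<open>
  With \<open>x = 1 - b i\<close>, the D2D probability is \<open>x - x ^ k\<close>, so file \<open>i\<close> contributes a nonnegative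
  multiple of \<open>(Pd / R1) * x + (Pb / R2 - Pd / R1) * x ^ k\<close>, which is convex in \<open>x \<ge> 0\<close>
  because the coefficient of \<open>x ^ k\<close> is nonnegative.
\<close>

text \<open>For empty or infinite \<open>I\<close> the sum is constantly 0, and only
  \<open>convex C\<close> yields convexity there.\<close>

lemma convex_on_sum_fun:
  assumes "convex C" and "\<And>i. i \<in> I \<Longrightarrow> convex_on C (f i)"
  shows "convex_on C (\<lambda>x. \<Sum>i\<in>I. f i x)"
  using assms(2)
  by (induction I rule: infinite_finite_induct) (simp_all add: assms(1) convex_on_const convex_on_add)

lemma convex_on_linear_compose:
  assumes "linear g" and "convex_on T f" and "convex C" and "g ` C \<subseteq> T"
  shows "convex_on C (\<lambda>x. f (g x))"
  using assms unfolding convex_on_def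
  by (simp add: linear_add linear_scale image_subset_iff)

lemma convex_on_power_nonneg: "convex_on {0::real..} (\<lambda>x. x ^ n)"
proof (cases "even n")
  case True
  then show ?thesis
    by (blast intro: convex_on_subset [OF convex_power_even])
qed (rule convex_power_odd)

text \<open>The affine map \<open>1 - x\<close> preserves convex combinations and sends
  \<open>{..1}\<close> into the half-line where every power, odd ones included, is convex.\<close>

lemma convex_on_power_one_minus:
  "convex_on {..1::real} (\<lambda>x. (1 - x) ^ n)"
proof (rule convex_onI)
  fix t x y :: real
  assume *: "0 < t" "t < 1" "x \<in> {..1}" "y \<in> {..1}"
  have "1 - ((1 - t) *\<^sub>R x + t *\<^sub>R y) = (1 - t) *\<^sub>R (1 - x) + t *\<^sub>R (1 - y)"
    by (simp add: algebra_simps)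
  with convex_onD [OF convex_on_power_nonneg, of t "1 - x" "1 - y" n] *
  show "(1 - ((1 - t) *\<^sub>R x + t *\<^sub>R y)) ^ n \<le> (1 - t) * (1 - x) ^ n + t * (1 - y) ^ n"
    by simp
qed simp

lemma zipf_nonneg: "zipf \<beta> N i \<ge> 0"
  by (simp add: zipf_def sum_nonneg)

text \<open>Truncated subtraction makes \<open>k = 0\<close> an exception: there the left side is 0
  and the right side is \<open>- b i\<close>.\<close>

lemma d2d_prob_eq:
  assumes "k \<ge> 1"
  shows "d2d_prob k b i = (1 - b i) - (1 - b i) ^ k"
  using assms by (cases k) (simp_all add: d2d_prob_def algebra_simps)

theorem lemma4:
  fixes \<beta> Pd Pb R1 R2 :: real
    and S :: "nat \<Rightarrow> real"
    and N k :: nat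
    and coord :: "nat \<Rightarrow> 'n::finite"
  assumes "bij_betw coord {1..N} (UNIV :: 'n set)"
    and "\<beta> \<ge> 0"
    and "k \<ge> 1"
    and "Pd > 0" and "Pb > 0" and "R1 > 0" and "R2 > 0"
    and "\<And>i. i \<in> {1..N} \<Longrightarrow> S i > 0"
    and "Pb / R2 > Pd / R1"
  shows "convex_on {b :: real ^ 'n. \<forall>m. b $ m \<in> {0..1}}
           (\<lambda>b. energy \<beta> N S Pd Pb R1 R2 k (\<lambda>i. b $ coord i))"
proof -
  define C :: "(real ^ 'n) set" where "C = {b. \<forall>m. b $ m \<in> {0..1}}"
  \<comment> \<open>Leaving interval membership folded reduces the premise of the box rule to
    convexity of \<open>{0..1}\<close>.\<close>
  have C: "convex C"
    using convex_box_cart [of "\<lambda>i x. x \<in> {0..1::real}"] by (simp add: C_def del: atLeastAtMost_iff)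
  define w where "w i = zipf \<beta> N i * S i" for i
  \<comment> \<open>The exponent 1 lets \<open>convex_on_power_one_minus\<close> cover both
    terms.\<close>
  define h where "h x = Pd / R1 * (1 - x) ^ 1 + (Pb / R2 - Pd / R1) * (1 - x) ^ k" for x :: real
  have h: "convex_on {..1} h"
    unfolding h_def using assms
    by (intro convex_on_add convex_on_cmul convex_on_power_one_minus) auto
  have "convex_on C (\<lambda>b. w i * h (b $ coord i))" if "i \<in> {1..N}" for i
  proof (rule convex_on_cmul)
    show "0 \<le> w i"
      using that assms(8) by (simp add: w_def zipf_nonneg less_imp_le)
    \<comment> \<open>A coordinate projection is linear and maps the box into \<open>{..1}\<close>,
      so convexity of \<open>h\<close> in one variable lifts to the whole vector.\<close>
    show "convex_on C (\<lambda>b. h (b $ coord i))"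
      by (rule convex_on_linear_compose [OF _ h C])
        (auto simp: C_def intro: linearI)
  qed
  then have "convex_on C (\<lambda>b. \<Sum>j=1..k. \<Sum>i=1..N. w i * h (b $ coord i))"
    by (intro convex_on_sum_fun C)
  moreover have "energy \<beta> N S Pd Pb R1 R2 k (\<lambda>i. b $ coord i) =
      (\<Sum>j=1..k. \<Sum>i=1..N. w i * h (b $ coord i))" for b :: "real ^ 'n"
    unfolding energy_def
    by (intro sum.cong refl)
      (simp add: d2d_prob_eq [OF assms(3)] bs_prob_def w_def h_def diff_divide_distrib algebra_simps)
  ultimately show ?thesis
    by (simp add: C_def)
qed

end
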